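(* Let $F$ be a field of prime characteristic $p$, let $r,s\geq 1$ be integers, and suppose that $V_r\otimes V_s=\bigoplus_{i=1}^{b}V_{\lambda_i}$ with $b=\min(r,s)$ and $\lambda_1\geq\cdots\geq\lambda_b>0$ (equivalently, $\lambda(r,s,p)=(\lambda_1,\dots,\lambda_b)$). Then the $p$-parts of $\operatorname{lcm}(r,s)$ and $\gcd(\lambda_1,\dots,\lambda_b)$ are equal, that is, $$\operatorname{lcm}(r,s)_p=\gcd(\lambda_1,\dots,\lambda_b)_p.$$
   Context: $F$ is a field of prime characteristic $p$. For a nonzero integer $n$, its $p$-part $n_p$ is the largest power of $p$ dividing $n$. $J_r(1)$ denotes the $r\times r$ Jordan block over $F$ with eigenvalue $1$. For $r,s\geq1$, the Jordan partition $\lambda(r,s,p)=(\lambda_1,\dots,\lambda_b)$, with $\lambda_1\geq\cdots\geq\lambda_b>0$ and $\lambda_1+\cdots+\lambda_b=rs$, is the list of Jordan block sizes of $J_r(1)\otimes J_s(1)$, i.e. $J_r(1)\otimes J_s(1)$ is similar to $J_{\lambda_1}(1)\oplus\cdots\oplus J_{\lambda_b}(1)$; it depends only on $r,s,p$, and it is known that $b=\min(r,s)$. For $r\le p^n$, $V_r$ is the indecomposable $r$-dimensional module over $F$ of the cyclic group $C_{p^n}$ on which a fixed generator acts as $J_r(1)$ (regarded as a module for every $C_{p^n}$ with $p^n\geq r$). The module decomposition $V_r\otimes V_s= V_{\lambda_1}\oplus\cdots\oplus V_{\lambda_b}$ (up to isomorphism, for any $n$ with $\max(r,s)\leq p^n$)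 is equivalent to $\lambda(r,s,p)=(\lambda_1,\dots,\lambda_b)$. *)

theory Defs
  imports
    "Jordan_Normal_Form.Jordan_Normal_Form"
    "HOL-Computational_Algebra.Primes"
begin

text \<open>
  Kronecker product: the matrix of \<open>A \<otimes> B\<close> in the basis \<open>e\<^sub>i \<otimes> f\<^sub>j\<close>, ordered lexicographically,
  so that \<open>e\<^sub>i \<otimes> f\<^sub>j\<close> has index \<open>i * dim B + j\<close>.
\<close>

definition kronecker :: "'a :: times mat \<Rightarrow> 'a mat \<Rightarrow> 'a mat" where
  "kronecker A B = mat (dim_row A * dim_row B) (dim_col A * dim_col B)
     (\<lambda>(i, j). A $$ (i div dim_row B, j div dim_col B) * B $$ (i mod dim_row B, j mod dim_col B))"

text \<open>
  The list \<open>ls\<close> is the Jordan partition of \<open>(r, s)\<close> over the field \<open>'a\<close>. The predicate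
  \<^const>\<open>jordan_nf\<close> says that the matrix is similar to the block diagonal matrix with the given
  Jordan blocks and that no block has size zero; hence the entries of \<open>ls\<close> are positive.
\<close>

definition jordan_partition :: "'a :: field itself \<Rightarrow> nat \<Rightarrow> nat \<Rightarrow> nat list \<Rightarrow> bool" where
  "jordan_partition _ r s ls \<longleftrightarrow>
     sorted_wrt (\<ge>) ls \<and>
     jordan_nf (kronecker (jordan_block r (1 :: 'a)) (jordan_block s 1)) (map (\<lambda>l. (l, 1)) ls)"

text \<open>The \<open>p\<close>-part of \<open>n\<close>; the intended use is for \<open>p\<close> prime and \<open>n > 0\<close>.\<close>

definition p_part :: "nat \<Rightarrow> nat \<Rightarrow> nat" where
  "p_part p n = p ^ multiplicity p n"

end

theory Submission
  imports Defs
begin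

text \<open>
  Let \<open>G = J\<^sub>r(1) \<otimes> J\<^sub>s(1)\<close> and let \<open>q\<close> be the \<open>p\<close>-part of \<open>lcm r s\<close>, so that \<open>q\<close> divides \<open>r\<close> or \<open>s\<close>
  while \<open>p q\<close> divides neither.

  That \<open>q\<close> divides every block size is Higman's criterion for projectivity relative to the
  subgroup of index \<open>q\<close>: such projectivity of one tensor factor passes to the tensor product and
  then to each of its summands, and a Jordan block of size \<open>l\<close> has it iff \<open>q\<close> divides \<open>l\<close>.

  If \<open>p q\<close> divided every block size, then every matrix commuting with \<open>G\<^sup>q\<close> would have trace \<open>0\<close>:
  on a block of size \<open>l\<close> the diagonal of such a matrix has period \<open>q\<close>, so its sum is a multiple of
  \<open>l / q\<close>. But \<open>G\<^sup>q\<close> commutes with the projection onto the span of the \<open>e\<^sub>i \<otimes> f\<^sub>j\<close> with \<open>i\<close>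
  and \<open>j\<close> in prescribed residue classes mod \<open>q\<close>, and for suitable classes the number of such
  \<open>(i, j)\<close> is prime to \<open>p\<close>.
\<close>

subsection \<open>Unipotent Jordan blocks in characteristic p\<close>

lemma CHAR_prime_power_choose_eq_0:
  assumes "prime p" and "CHAR('a :: comm_ring_1) = p" and "0 < d" and "d < p ^ e"
  shows "of_nat (p ^ e choose d) = (0 :: 'a)"
proof -
  have "p dvd (p ^ e choose d)"
  proof (rule ccontr)
    assume "\<not> p dvd (p ^ e choose d)"
    with assms(1) have cop: "coprime (p ^ e) (p ^ e choose d)"
      by (simp add: prime_imp_coprime)
    have "d * (p ^ e choose d) = p ^ e * (p ^ e - 1 choose (d - 1))"
      using assms(3) by (rule times_binomial_minus1_eq)
    then have "p ^ e dvd d * (p ^ e choose d)"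
      by simp
    with cop have "p ^ e dvd d"
      by (simp add: coprime_dvd_mult_left_iff)
    with assms(3,4) show False
      using dvd_imp_le by fastforce
  qed
  with assms(2) show ?thesis
    by (simp add: of_nat_eq_0_iff_char_dvd)
qed

definition unip :: "nat \<Rightarrow> nat \<Rightarrow> 'a :: semiring_1 mat" where
  "unip n t = mat n n (\<lambda>(i, j). if i = j \<or> i + t = j then 1 else 0)"

lemma unip_carrier [simp]: "unip n t \<in> carrier_mat n n"
  by (simp add: unip_def)

lemma jordan_block_1_eq_unip: "jordan_block n 1 = unip n 1"
  by (rule eq_matI) (auto simp: unip_def)

lemma jordan_block_1_pow_eq_unip:
  assumes "prime p" and "CHAR('a :: comm_ring_1) = p"
  shows "jordan_block n (1 :: 'a) ^\<^sub>m (p ^ e) = unip n (p ^ e)"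
proof (rule eq_matI)
  fix i j assume "i < dim_row (unip n (p ^ e) :: 'a mat)" "j < dim_col (unip n (p ^ e) :: 'a mat)"
  then have ij: "i < n" "j < n"
    by (simp_all add: unip_def)
  consider "j < i" | "i = j" | "i < j" "j < i + p ^ e" | "j = i + p ^ e" | "j > i + p ^ e"
    by linarith
  then show "(jordan_block n (1 :: 'a) ^\<^sub>m (p ^ e)) $$ (i, j) = unip n (p ^ e) $$ (i, j)"
  proof cases
    case 3
    then have "of_nat (p ^ e choose (j - i)) = (0 :: 'a)"
      by (intro CHAR_prime_power_choose_eq_0[OF assms]) auto
    with 3 ij show ?thesis
      by (simp add: jordan_block_pow unip_def)
  qed (use ij in \<open>auto simp: jordan_block_pow unip_def binomial_eq_0\<close>)
qed (auto simp: unip_def)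

lemma mult_unip_index:
  fixes M :: "'a :: semiring_1 mat"
  assumes "M \<in> carrier_mat n n" "i < n" "j < n" "t > 0"
  shows "(M * unip n t) $$ (i, j) = M $$ (i, j) + (if t \<le> j then M $$ (i, j - t) else 0)"
proof -
  have "(M * unip n t) $$ (i, j) = (\<Sum>k\<in>{0..<n}. M $$ (i, k) * (if k = j \<or> k + t = j then 1 else 0))"
    using assms by (auto simp: times_mat_def scalar_prod_def unip_def intro!: sum.cong)
  also have "\<dots> = (\<Sum>k\<in>{0..<n}. (if k = j then M $$ (i, j) else 0)
                   + (if k = j - t then if t \<le> j then M $$ (i, j - t) else 0 else 0))"
    using assms by (intro sum.cong) auto
  also have "\<dots> = M $$ (i, j) + (if t \<le> j then M $$ (i, j - t) else 0)"
    using assms less_imp_diff_less[of j n t] by (simp add: sum.distrib)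
  finally show ?thesis .
qed

lemma unip_mult_index:
  fixes M :: "'a :: semiring_1 mat"
  assumes "M \<in> carrier_mat n n" "i < n" "j < n" "t > 0"
  shows "(unip n t * M) $$ (i, j) = M $$ (i, j) + (if i + t < n then M $$ (i + t, j) else 0)"
proof -
  have "(unip n t * M) $$ (i, j) = (\<Sum>k\<in>{0..<n}. (if i = k \<or> i + t = k then 1 else 0) * M $$ (k, j))"
    using assms by (auto simp: times_mat_def scalar_prod_def unip_def intro!: sum.cong)
  also have "\<dots> = (\<Sum>k\<in>{0..<n}. (if k = i then M $$ (i, j) else 0)
                   + (if k = i + t then M $$ (i + t, j) else 0))"
    using assms by (intro sum.cong) auto
  also have "\<dots> = M $$ (i, j) + (if i + t < n then M $$ (i + t, j) else 0)"
    using assms by (simp add: sum.distrib)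
  finally show ?thesis .
qed

lemma unip_commute_iff:
  fixes M :: "'a :: ring_1 mat"
  assumes "M \<in> carrier_mat n n" "t > 0"
  shows "M * unip n t = unip n t * M \<longleftrightarrow>
    (\<forall>i<n. \<forall>j<n. (if t \<le> j then M $$ (i, j - t) else 0) = (if i + t < n then M $$ (i + t, j) else 0))"
    (is "?L \<longleftrightarrow> ?R")
proof
  assume ?L
  show ?R
  proof (intro allI impI)
    fix i j assume ij: "i < n" "j < n"
    have "(M * unip n t) $$ (i, j) = (unip n t * M) $$ (i, j)"
      by (simp only: \<open>?L\<close>)
    then show "(if t \<le> j then M $$ (i, j - t) else 0) = (if i + t < n then M $$ (i + t, j) else 0)"
      unfolding mult_unip_index[OF assms(1) ij assms(2)] unip_mult_index[OF assms(1) ij assms(2)]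
      by (rule add_left_imp_eq)
  qed
next
  assume ?R
  then show ?L
    using assms by (intro eq_matI)
      (auto simp: mult_unip_index unip_mult_index carrier_matD[OF unip_carrier] simp del: index_mult_mat(1))
qed

subsection \<open>Traces and Kronecker products\<close>

definition trace :: "'a :: comm_monoid_add mat \<Rightarrow> 'a" where
  "trace A = (\<Sum>i<dim_row A. A $$ (i, i))"

lemma trace_mult_commute:
  fixes A B :: "'a :: comm_semiring_1 mat"
  assumes "A \<in> carrier_mat n m" "B \<in> carrier_mat m n"
  shows "trace (A * B) = trace (B * A)"
proof -
  have "trace (A * B) = (\<Sum>i<n. \<Sum>j<m. A $$ (i, j) * B $$ (j, i))"
    using assms by (auto simp: trace_def scalar_prod_def atLeast0LessThan intro!: sum.cong)
  also have "\<dots> = (\<Sum>j<m. \<Sum>i<n. B $$ (j, i) * A $$ (i, j))"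
    by (subst sum.swap) (simp add: mult.commute)
  also have "\<dots> = trace (B * A)"
    using assms by (auto simp: trace_def scalar_prod_def atLeast0LessThan intro!: sum.cong)
  finally show ?thesis .
qed

lemma kronecker_carrier [simp]:
  "A \<in> carrier_mat n n' \<Longrightarrow> B \<in> carrier_mat m m' \<Longrightarrow> kronecker A B \<in> carrier_mat (n * m) (n' * m')"
  by (auto simp: kronecker_def)

lemma div_mod_less:
  fixes i n m :: nat
  assumes "i < n * m"
  shows "i div m < n" "i mod m < m"
  using assms by (auto simp: less_mult_imp_div_less) (metis gr0I mod_less_divisor mult_0_right not_less0)

lemma kronecker_index:
  assumes "A \<in> carrier_mat n n'" "B \<in> carrier_mat m m'" "i < n * m" "j < n' * m'"
  shows "kronecker A B $$ (i, j) = A $$ (i div m, j div m') * B $$ (i mod m, j mod m')"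
  using assms by (auto simp: kronecker_def)

lemma mult_add_less:
  fixes a b n m :: nat
  assumes "a < n" "b < m"
  shows "a * m + b < n * m"
proof -
  have "a * m + b < Suc a * m"
    using assms by simp
  also have "\<dots> \<le> n * m"
    using assms by (intro mult_right_mono) auto
  finally show ?thesis .
qed

lemma sum_div_mod:
  fixes f :: "nat \<Rightarrow> nat \<Rightarrow> 'a :: comm_monoid_add"
  shows "(\<Sum>k<n * m. f (k div m) (k mod m)) = (\<Sum>i<n. \<Sum>j<m. f i j)"
  unfolding sum.cartesian_product
  by (rule sum.reindex_bij_witness[where i = "\<lambda>(a, b). a * m + b" and j = "\<lambda>k. (k div m, k mod m)"])
    (auto simp: div_mod_less intro: mult_add_less)

lemma kronecker_mult:
  fixes A B C D :: "'a :: comm_semiring_1 mat"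
  assumes "A \<in> carrier_mat n n" "C \<in> carrier_mat n n" "B \<in> carrier_mat m m" "D \<in> carrier_mat m m"
  shows "kronecker A B * kronecker C D = kronecker (A * C) (B * D)"
proof (rule eq_matI)
  have AC: "A * C \<in> carrier_mat n n" and BD: "B * D \<in> carrier_mat m m"
    using assms by auto
  have AB: "kronecker A B \<in> carrier_mat (n * m) (n * m)"
    and CD: "kronecker C D \<in> carrier_mat (n * m) (n * m)"
    using assms by auto
  fix i j
  assume "i < dim_row (kronecker (A * C) (B * D))" "j < dim_col (kronecker (A * C) (B * D))"
  then have ij: "i < n * m" "j < n * m"
    using kronecker_carrier[OF AC BD] by auto
  note ij' = div_mod_less[OF ij(1)] div_mod_less[OF ij(2)]
  have "(kronecker A B * kronecker C D) $$ (i, j)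
      = (\<Sum>k<n * m. kronecker A B $$ (i, k) * kronecker C D $$ (k, j))"
    using AB CD ij by (auto simp: scalar_prod_def atLeast0LessThan)
  also have "\<dots> = (\<Sum>k<n * m. (A $$ (i div m, k div m) * B $$ (i mod m, k mod m)) *
                          (C $$ (k div m, j div m) * D $$ (k mod m, j mod m)))"
    using assms ij by (intro sum.cong) (simp_all add: kronecker_index)
  also have "\<dots> = (\<Sum>k<n. \<Sum>l<m. (A $$ (i div m, k) * B $$ (i mod m, l)) *
                          (C $$ (k, j div m) * D $$ (l, j mod m)))"
    by (rule sum_div_mod)
  also have "\<dots> = (\<Sum>k<n. A $$ (i div m, k) * C $$ (k, j div m)) *
                  (\<Sum>l<m. B $$ (i mod m, l) * D $$ (l, j mod m))"
    by (simp add: sum_product mult_ac)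
  also have "\<dots> = (A * C) $$ (i div m, j div m) * (B * D) $$ (i mod m, j mod m)"
    using assms ij' by (auto simp: scalar_prod_def atLeast0LessThan)
  also have "\<dots> = kronecker (A * C) (B * D) $$ (i, j)"
    using AC BD ij by (simp add: kronecker_index)
  finally show "(kronecker A B * kronecker C D) $$ (i, j) = kronecker (A * C) (B * D) $$ (i, j)" .
qed (use assms in \<open>auto simp: kronecker_def\<close>)

lemma kronecker_one: "kronecker (1\<^sub>m n) (1\<^sub>m m :: 'a :: comm_semiring_1 mat) = 1\<^sub>m (n * m)"
proof (rule eq_matI)
  fix i j assume "i < dim_row (1\<^sub>m (n * m) :: 'a mat)" "j < dim_col (1\<^sub>m (n * m) :: 'a mat)"
  then have ij: "i < n * m" "j < n * m"
    by simp_all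
  have "i = j \<longleftrightarrow> i div m = j div m \<and> i mod m = j mod m"
    by (metis div_mult_mod_eq)
  then show "kronecker (1\<^sub>m n) (1\<^sub>m m :: 'a mat) $$ (i, j) = 1\<^sub>m (n * m) $$ (i, j)"
    using ij div_mod_less[OF ij(1)] div_mod_less[OF ij(2)]
    by (subst kronecker_index[of _ n n _ m m]) auto
qed (auto simp: kronecker_def)

lemma kronecker_pow:
  fixes A B :: "'a :: comm_semiring_1 mat"
  assumes "A \<in> carrier_mat n n" "B \<in> carrier_mat m m"
  shows "kronecker A B ^\<^sub>m k = kronecker (A ^\<^sub>m k) (B ^\<^sub>m k)"
proof (induction k)
  case 0
  then show ?case
    using carrier_matD(1)[OF kronecker_carrier[OF assms]] assms by (simp add: kronecker_one)
next
  case (Suc k)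
  then show ?case
    using assms by (simp add: kronecker_mult[of _ n _ _ m])
qed

lemma kronecker_add_left:
  fixes A B :: "'a :: comm_semiring_1 mat"
  assumes "A \<in> carrier_mat n n" "C \<in> carrier_mat n n" "B \<in> carrier_mat m m"
  shows "kronecker (A + C) B = kronecker A B + kronecker C B"
proof (rule eq_matI)
  fix i j assume "i < dim_row (kronecker A B + kronecker C B)" "j < dim_col (kronecker A B + kronecker C B)"
  then have ij: "i < n * m" "j < n * m"
    using assms by (auto simp: kronecker_def)
  with assms div_mod_less[OF ij(1)] div_mod_less[OF ij(2)]
  show "kronecker (A + C) B $$ (i, j) = (kronecker A B + kronecker C B) $$ (i, j)"
    by (simp add: kronecker_def distrib_left distrib_right)
qed (use assms in \<open>auto simp: kronecker_def\<close>)

lemma kronecker_add_right: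
  fixes A B :: "'a :: comm_semiring_1 mat"
  assumes "A \<in> carrier_mat n n" "B \<in> carrier_mat m m" "C \<in> carrier_mat m m"
  shows "kronecker A (B + C) = kronecker A B + kronecker A C"
proof (rule eq_matI)
  fix i j assume "i < dim_row (kronecker A B + kronecker A C)" "j < dim_col (kronecker A B + kronecker A C)"
  then have ij: "i < n * m" "j < n * m"
    using assms by (auto simp: kronecker_def)
  with assms div_mod_less[OF ij(1)] div_mod_less[OF ij(2)]
  show "kronecker A (B + C) $$ (i, j) = (kronecker A B + kronecker A C) $$ (i, j)"
    by (simp add: kronecker_def distrib_left distrib_right)
qed (use assms in \<open>auto simp: kronecker_def\<close>)

lemma trace_kronecker:
  fixes A B :: "'a :: comm_semiring_1 mat"
  assumes "A \<in> carrier_mat n n" "B \<in> carrier_mat m m"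
  shows "trace (kronecker A B) = trace A * trace B"
proof -
  have "trace (kronecker A B) = (\<Sum>k<n * m. A $$ (k div m, k div m) * B $$ (k mod m, k mod m))"
    unfolding trace_def carrier_matD(1)[OF kronecker_carrier[OF assms]]
    by (intro sum.cong) (simp_all add: kronecker_index[OF assms])
  also have "\<dots> = (\<Sum>i<n. \<Sum>j<m. A $$ (i, i) * B $$ (j, j))"
    by (rule sum_div_mod)
  finally show ?thesis
    using assms by (auto simp: trace_def sum_product)
qed

subsection \<open>Relative projectivity\<close>

text \<open>
  For invertible \<open>X\<close>, conjugation \<open>\<sigma>\<close> by \<open>X\<close> satisfies \<open>(\<sigma> - 1) (\<psi> (k + 1)) = \<psi> k\<close>. If \<open>q\<close> is a
  power of the characteristic, then \<open>(\<sigma> - 1)\<^bsup>q - 1\<^esup> = 1 + \<sigma> + \<dots> + \<sigma>\<^bsup>q - 1\<^esup>\<close>, so the identity is the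
  relative trace of \<open>\<psi> (q - 1)\<close>, which commutes with \<open>X\<^sup>q\<close>: this is Higman's criterion. The chain form
  avoids both inverses and sums of conjugates.
\<close>

definition rel_projective :: "nat \<Rightarrow> 'a :: semiring_1 mat \<Rightarrow> bool" where
  "rel_projective q X \<longleftrightarrow> (\<exists>\<psi>.
     \<psi> 0 = 1\<^sub>m (dim_row X) \<and>
     (\<forall>k<q. \<psi> k \<in> carrier_mat (dim_row X) (dim_row X)) \<and>
     (\<forall>k<q. \<psi> k * X ^\<^sub>m q = X ^\<^sub>m q * \<psi> k) \<and>
     (\<forall>k. Suc k < q \<longrightarrow> X * \<psi> (Suc k) = \<psi> (Suc k) * X + \<psi> k * X))"

lemma rel_projectiveI:
  assumes "X \<in> carrier_mat n n" "\<psi> 0 = 1\<^sub>m n"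
    and "\<And>k. k < q \<Longrightarrow> \<psi> k \<in> carrier_mat n n"
    and "\<And>k. k < q \<Longrightarrow> \<psi> k * X ^\<^sub>m q = X ^\<^sub>m q * \<psi> k"
    and "\<And>k. Suc k < q \<Longrightarrow> X * \<psi> (Suc k) = \<psi> (Suc k) * X + \<psi> k * X"
  shows "rel_projective q X"
  unfolding rel_projective_def using assms by (intro exI[of _ \<psi>]) auto

lemma rel_projectiveE:
  assumes "rel_projective q X" "X \<in> carrier_mat n n"
  obtains \<psi> where "\<psi> 0 = 1\<^sub>m n"
    and "\<And>k. k < q \<Longrightarrow> \<psi> k \<in> carrier_mat n n"
    and "\<And>k. k < q \<Longrightarrow> \<psi> k * X ^\<^sub>m q = X ^\<^sub>m q * \<psi> k"
    and "\<And>k. Suc k < q \<Longrightarrow> X * \<psi> (Suc k) = \<psi> (Suc k) * X + \<psi> k * X"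
  using assms unfolding rel_projective_def by auto

lemma rel_projective_transfer:
  assumes X: "X \<in> carrier_mat n n" and Y: "Y \<in> carrier_mat m m"
    and "f (1\<^sub>m n) = 1\<^sub>m m"
    and "\<And>M. M \<in> carrier_mat n n \<Longrightarrow> f M \<in> carrier_mat m m"
    and f_add: "\<And>M N. M \<in> carrier_mat n n \<Longrightarrow> N \<in> carrier_mat n n \<Longrightarrow> f (M + N) = f M + f N"
    and f_right: "\<And>M i. M \<in> carrier_mat n n \<Longrightarrow> f (M * X ^\<^sub>m i) = f M * Y ^\<^sub>m i"
    and f_left: "\<And>M i. M \<in> carrier_mat n n \<Longrightarrow> f (X ^\<^sub>m i * M) = Y ^\<^sub>m i * f M"
    and "rel_projective q X"
  shows "rel_projective q Y"
proof -
  obtain \<psi> where \<psi>: "\<psi> 0 = 1\<^sub>m n"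
    and carr: "\<And>k. k < q \<Longrightarrow> \<psi> k \<in> carrier_mat n n"
    and comm: "\<And>k. k < q \<Longrightarrow> \<psi> k * X ^\<^sub>m q = X ^\<^sub>m q * \<psi> k"
    and step: "\<And>k. Suc k < q \<Longrightarrow> X * \<psi> (Suc k) = \<psi> (Suc k) * X + \<psi> k * X"
    using assms(8) X by (rule rel_projectiveE) metis
  have X1: "X ^\<^sub>m 1 = X" and Y1: "Y ^\<^sub>m 1 = Y"
    using X Y by auto
  show ?thesis
  proof (rule rel_projectiveI[OF Y, of "\<lambda>k. f (\<psi> k)"])
    fix k assume k: "Suc k < q"
    have "Y * f (\<psi> (Suc k)) = f (X * \<psi> (Suc k))"
      using f_left[OF carr[OF k], of 1] unfolding X1 Y1 by simp
    also have "\<dots> = f (\<psi> (Suc k) * X) + f (\<psi> k * X)"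
      using step[OF k] carr[OF k] carr[of k] k X by (simp add: f_add)
    also have "\<dots> = f (\<psi> (Suc k)) * Y + f (\<psi> k) * Y"
      using f_right[OF carr[OF k], of 1] f_right[OF carr[of k], of 1] k unfolding X1 Y1 by simp
    finally show "Y * f (\<psi> (Suc k)) = f (\<psi> (Suc k)) * Y + f (\<psi> k) * Y" .
  next
    fix k assume k: "k < q"
    show "f (\<psi> k) * Y ^\<^sub>m q = Y ^\<^sub>m q * f (\<psi> k)"
      using comm[OF k] f_left[OF carr[OF k]] f_right[OF carr[OF k]] by metis
  qed (use assms(3,4) \<psi> carr in auto)
qed

lemma rel_projective_kronecker_right:
  fixes A B :: "'a :: comm_semiring_1 mat"
  assumes A: "A \<in> carrier_mat n n" and B: "B \<in> carrier_mat m m" and "rel_projective q B"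
  shows "rel_projective q (kronecker A B)"
proof -
  obtain \<psi> where \<psi>: "\<psi> 0 = 1\<^sub>m m"
    and carr: "\<And>k. k < q \<Longrightarrow> \<psi> k \<in> carrier_mat m m"
    and comm: "\<And>k. k < q \<Longrightarrow> \<psi> k * B ^\<^sub>m q = B ^\<^sub>m q * \<psi> k"
    and step: "\<And>k. Suc k < q \<Longrightarrow> B * \<psi> (Suc k) = \<psi> (Suc k) * B + \<psi> k * B"
    using assms(3) B by (rule rel_projectiveE) metis
  show ?thesis
  proof (rule rel_projectiveI[OF kronecker_carrier[OF A B], of "\<lambda>k. kronecker (1\<^sub>m n) (\<psi> k)"])
    fix k assume k: "Suc k < q"
    note c = carr[OF k] carr[OF Suc_lessD[OF k]]
    then have c': "\<psi> (Suc k) * B \<in> carrier_mat m m" "\<psi> k * B \<in> carrier_mat m m"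
      using B by auto
    show "kronecker A B * kronecker (1\<^sub>m n) (\<psi> (Suc k)) =
      kronecker (1\<^sub>m n) (\<psi> (Suc k)) * kronecker A B + kronecker (1\<^sub>m n) (\<psi> k) * kronecker A B"
      using A B c c' by (simp add: kronecker_mult[of _ n _ _ m] step[OF k] kronecker_add_right[of _ n _ m])
  next
    fix k assume k: "k < q"
    show "kronecker (1\<^sub>m n) (\<psi> k) * kronecker A B ^\<^sub>m q = kronecker A B ^\<^sub>m q * kronecker (1\<^sub>m n) (\<psi> k)"
      using A B carr[OF k] left_mult_one_mat[of "A ^\<^sub>m q" n n] right_mult_one_mat[of "A ^\<^sub>m q" n n]
      by (simp add: kronecker_pow[OF A B] kronecker_mult[of _ n _ _ m] comm[OF k])
  qed (use \<psi> carr in \<open>auto simp: kronecker_one\<close>)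
qed

lemma rel_projective_kronecker_left:
  fixes A B :: "'a :: comm_semiring_1 mat"
  assumes A: "A \<in> carrier_mat n n" and B: "B \<in> carrier_mat m m" and "rel_projective q A"
  shows "rel_projective q (kronecker A B)"
proof -
  obtain \<psi> where \<psi>: "\<psi> 0 = 1\<^sub>m n"
    and carr: "\<And>k. k < q \<Longrightarrow> \<psi> k \<in> carrier_mat n n"
    and comm: "\<And>k. k < q \<Longrightarrow> \<psi> k * A ^\<^sub>m q = A ^\<^sub>m q * \<psi> k"
    and step: "\<And>k. Suc k < q \<Longrightarrow> A * \<psi> (Suc k) = \<psi> (Suc k) * A + \<psi> k * A"
    using assms(3) A by (rule rel_projectiveE) metis
  show ?thesis
  proof (rule rel_projectiveI[OF kronecker_carrier[OF A B], of "\<lambda>k. kronecker (\<psi> k) (1\<^sub>m m)"])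
    fix k assume k: "Suc k < q"
    note c = carr[OF k] carr[OF Suc_lessD[OF k]]
    then have c': "\<psi> (Suc k) * A \<in> carrier_mat n n" "\<psi> k * A \<in> carrier_mat n n"
      using A by auto
    show "kronecker A B * kronecker (\<psi> (Suc k)) (1\<^sub>m m) =
      kronecker (\<psi> (Suc k)) (1\<^sub>m m) * kronecker A B + kronecker (\<psi> k) (1\<^sub>m m) * kronecker A B"
      using A B c c' by (simp add: kronecker_mult[of _ n _ _ m] step[OF k] kronecker_add_left[of _ n _ _ m])
  next
    fix k assume k: "k < q"
    show "kronecker (\<psi> k) (1\<^sub>m m) * kronecker A B ^\<^sub>m q = kronecker A B ^\<^sub>m q * kronecker (\<psi> k) (1\<^sub>m m)"
      using A B carr[OF k] left_mult_one_mat[of "B ^\<^sub>m q" m m] right_mult_one_mat[of "B ^\<^sub>m q" m m]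
      by (simp add: kronecker_pow[OF A B] kronecker_mult[of _ n _ _ m] comm[OF k])
  qed (use \<psi> carr in \<open>auto simp: kronecker_one\<close>)
qed

text \<open>
  The transposed Hasse derivative \<open>x\<^sup>i \<mapsto> (i choose k) x\<^bsup>i - k\<^esup>\<close> on the basis \<open>1, x, \<dots>, x\<^bsup>n - 1\<^esup>\<close>. For \<open>q\<close>
  a power of \<open>p\<close> and \<open>k < q\<close>, replacing \<open>i\<close> by \<open>i mod q\<close> does not change the binomial coefficient
  mod \<open>p\<close>; it makes the terms at the boundary \<open>i = n\<close> vanish visibly when \<open>q\<close> divides \<open>n\<close>.
\<close>

definition hasse :: "nat \<Rightarrow> nat \<Rightarrow> nat \<Rightarrow> 'a :: semiring_1 mat" where
  "hasse q n k = mat n n (\<lambda>(i, j). if i = j + k then of_nat (i mod q choose k) else 0)"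

lemma hasse_carrier [simp]: "hasse q n k \<in> carrier_mat n n"
  by (simp add: hasse_def)

lemma Suc_mod_eq_Suc: "Suc (i mod q) \<noteq> q \<Longrightarrow> Suc i mod q = Suc (i mod q)"
  by (simp add: mod_Suc)

lemma of_nat_choose_Suc_mod:
  assumes "prime p" and "CHAR('a :: comm_ring_1) = p" and "Suc k < p ^ e"
  shows "of_nat (Suc i mod p ^ e choose Suc k)
    = (of_nat (i mod p ^ e choose Suc k) + of_nat (i mod p ^ e choose k) :: 'a)"
proof (cases "Suc (i mod p ^ e) = p ^ e")
  case True
  have "of_nat (i mod p ^ e choose Suc k) + of_nat (i mod p ^ e choose k)
      = (of_nat (Suc (i mod p ^ e) choose Suc k) :: 'a)"
    by simp
  also have "\<dots> = 0"
    unfolding True using assms by (intro CHAR_prime_power_choose_eq_0) auto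
  finally show ?thesis
    using True by (simp add: mod_Suc)
next
  case False
  then show ?thesis
    by (simp add: Suc_mod_eq_Suc)
qed

lemma hasse_unip_1:
  assumes "prime p" and "CHAR('a :: comm_ring_1) = p" and "Suc k < p ^ e" and "p ^ e dvd n"
  shows "unip n 1 * hasse (p ^ e) n (Suc k) = hasse (p ^ e) n (Suc k) * unip n 1 + (hasse (p ^ e) n k :: 'a mat)"
proof (rule eq_matI)
  let ?q = "p ^ e"
  let ?D = "hasse ?q n :: nat \<Rightarrow> 'a mat"
  fix i j assume "i < dim_row (?D (Suc k) * unip n 1 + ?D k)" "j < dim_col (?D (Suc k) * unip n 1 + ?D k)"
  then have ij: "i < n" "j < n"
    by (simp_all add: hasse_def)
  note Pascal = of_nat_choose_Suc_mod[OF assms(1-3), of i]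
  have edge: "of_nat (Suc i mod ?q choose Suc k) = (0 :: 'a)" if "\<not> Suc i < n"
  proof -
    from that ij have "Suc i = n" by simp
    with assms(4) have "Suc i mod ?q = 0" by simp
    then show ?thesis by simp
  qed
  have small: "k mod ?q choose Suc k = 0"
    by (simp add: binomial_eq_0 le_imp_less_Suc)
  have "(unip n 1 * ?D (Suc k)) $$ (i, j)
      = ?D (Suc k) $$ (i, j) + (if i + 1 < n then ?D (Suc k) $$ (i + 1, j) else 0)"
    using ij by (intro unip_mult_index) auto
  also have "\<dots> = ?D (Suc k) $$ (i, j) + (if i = j + k then of_nat (Suc i mod ?q choose Suc k) else 0)"
    using ij edge by (auto simp: hasse_def)
  also have "\<dots> = ?D (Suc k) $$ (i, j) + (if 1 \<le> j then ?D (Suc k) $$ (i, j - 1) else 0) + ?D k $$ (i, j)"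
    using ij small unfolding Pascal by (cases j) (auto simp: hasse_def binomial_eq_0)
  also have "\<dots> = (?D (Suc k) * unip n 1) $$ (i, j) + ?D k $$ (i, j)"
    using ij mult_unip_index[of "?D (Suc k)" n i j 1] by simp
  also have "\<dots> = (?D (Suc k) * unip n 1 + ?D k) $$ (i, j)"
    using ij by (subst index_add_mat) (auto simp: hasse_def)
  finally show "(unip n 1 * ?D (Suc k)) $$ (i, j) = (?D (Suc k) * unip n 1 + ?D k) $$ (i, j)" .
qed (auto simp: hasse_def unip_def)

lemma hasse_commute:
  assumes "0 < q" "q dvd n" "k < q"
  shows "hasse q n k * unip n q = unip n q * (hasse q n k :: 'a :: ring_1 mat)"
proof (subst unip_commute_iff)
  have last: "i mod q choose k = 0" if "i < n" "n \<le> i + q" "i + q < n + k" for i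
  proof -
    from that(1) have "q dvd n" "q \<le> n"
      using assms(2) by (auto dest: dvd_imp_le)
    then obtain c where c: "n - q = q * c"
      by (metis dvd_minus_self dvdE)
    define i' where "i' = i - (n - q)"
    have i: "i = i' + q * c"
      using that c by (auto simp: i'_def)
    have "i mod q \<le> i'"
      unfolding i by simp
    also have "i' < k"
      using that \<open>q \<le> n\<close> assms by (auto simp: i'_def)
    finally show ?thesis
      by (simp add: binomial_eq_0)
  qed
  have first: "i mod q choose k = 0" if "i + q = j + k" "j < q" for i j
    using that by (intro binomial_eq_0 le_less_trans[OF mod_less_eq_dividend]) auto
  show "\<forall>i<n. \<forall>j<n. (if q \<le> j then hasse q n k $$ (i, j - q) else 0) =
      (if i + q < n then hasse q n k $$ (i + q, j) else (0 :: 'a))"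
  proof (intro allI impI)
    fix i j assume ij: "i < n" "j < n"
    consider "i + q \<noteq> j + k" | "i + q = j + k" "q \<le> j" "i + q < n"
      | "i + q = j + k" "j < q" | "i + q = j + k" "q \<le> j" "n \<le> i + q"
      by linarith
    then show "(if q \<le> j then hasse q n k $$ (i, j - q) else 0) =
        (if i + q < n then hasse q n k $$ (i + q, j) else (0 :: 'a))"
    proof cases
      case 1
      then show ?thesis
        using ij by (auto simp: hasse_def)
    next
      case 2
      have "(i + q) mod q = i mod q"
        by simp
      moreover have "i = j - q + k"
        using 2 by simp
      ultimately show ?thesis
        using 2 ij by (simp add: hasse_def)
    next
      case 3
      then have "(j + k) mod q = i mod q"
        by (metis mod_add_self2)
      with 3 show ?thesis
        using ij first[OF 3] by (auto simp: hasse_def binomial_eq_0)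
    next
      case 4
      then show ?thesis
        using ij last[of i] by (auto simp: hasse_def binomial_eq_0)
    qed
  qed
qed (use assms in auto)

lemma mat_commute_pow:
  fixes A B :: "'a :: semiring_1 mat"
  assumes A: "A \<in> carrier_mat n n" and B: "B \<in> carrier_mat n n" and "A * B = B * A"
  shows "A * B ^\<^sub>m k = B ^\<^sub>m k * A"
proof (induction k)
  case 0
  then show ?case
    using A B by simp
next
  case (Suc k)
  have Bk: "B ^\<^sub>m k \<in> carrier_mat n n"
    using B by simp
  have "A * (B ^\<^sub>m k * B) = A * B ^\<^sub>m k * B"
    by (simp add: assoc_mult_mat[OF A Bk B])
  also have "\<dots> = B ^\<^sub>m k * (A * B)"
    unfolding Suc.IH by (simp add: assoc_mult_mat[OF Bk A B])
  also have "\<dots> = B ^\<^sub>m k * B * A"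
    unfolding assms(3) by (simp add: assoc_mult_mat[OF Bk B A])
  finally show ?case
    by simp
qed

lemma rel_projective_jordan_block:
  assumes "prime p" and "CHAR('a :: comm_ring_1) = p" and "p ^ e dvd n"
  shows "rel_projective (p ^ e) (jordan_block n (1 :: 'a))"
proof -
  let ?q = "p ^ e" and ?J = "jordan_block n (1 :: 'a)"
  let ?D = "hasse ?q n :: nat \<Rightarrow> 'a mat"
  have q0: "?q > 0"
    using assms(1) by (simp add: prime_gt_0_nat)
  have J: "?J \<in> carrier_mat n n" and Jk: "\<And>k. ?J ^\<^sub>m k \<in> carrier_mat n n"
    by simp_all
  have D: "\<And>k. ?D k \<in> carrier_mat n n"
    by simp
  have J_pow_commute: "?J ^\<^sub>m j * ?J ^\<^sub>m k = ?J ^\<^sub>m k * ?J ^\<^sub>m j" for j k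
    by (intro mat_commute_pow[OF Jk J] mat_commute_pow[OF J J, symmetric] refl)
  show ?thesis
  proof (rule rel_projectiveI[OF J, of "\<lambda>k. ?D k * ?J ^\<^sub>m k"])
    show "?D 0 * ?J ^\<^sub>m 0 = 1\<^sub>m n"
      by (rule eq_matI) (auto simp: hasse_def)
  next
    fix k assume k: "k < ?q"
    have "?D k * ?J ^\<^sub>m k * ?J ^\<^sub>m ?q = ?D k * (?J ^\<^sub>m ?q * ?J ^\<^sub>m k)"
      by (simp add: assoc_mult_mat[OF D Jk Jk] J_pow_commute)
    also have "\<dots> = ?D k * ?J ^\<^sub>m ?q * ?J ^\<^sub>m k"
      by (simp add: assoc_mult_mat[OF D Jk Jk])
    also have "?D k * ?J ^\<^sub>m ?q = ?J ^\<^sub>m ?q * ?D k"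
      unfolding jordan_block_1_pow_eq_unip[OF assms(1,2)]
      by (rule hasse_commute) (use q0 assms k in auto)
    finally show "?D k * ?J ^\<^sub>m k * ?J ^\<^sub>m ?q = ?J ^\<^sub>m ?q * (?D k * ?J ^\<^sub>m k)"
      by (simp add: assoc_mult_mat[OF Jk D Jk])
  next
    fix k assume k: "Suc k < ?q"
    have "?J * (?D (Suc k) * ?J ^\<^sub>m Suc k) = (?J * ?D (Suc k)) * ?J ^\<^sub>m Suc k"
      by (rule assoc_mult_mat[OF J D Jk, symmetric])
    also have "?J * ?D (Suc k) = ?D (Suc k) * ?J + ?D k"
      unfolding jordan_block_1_eq_unip by (rule hasse_unip_1[OF assms(1,2) k assms(3)])
    also have "(?D (Suc k) * ?J + ?D k) * ?J ^\<^sub>m Suc k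
        = ?D (Suc k) * ?J * ?J ^\<^sub>m Suc k + ?D k * ?J ^\<^sub>m Suc k"
      by (intro add_mult_distrib_mat[of _ n n _ _ n] mult_carrier_mat[OF D J] D Jk)
    also have "?D (Suc k) * ?J * ?J ^\<^sub>m Suc k = ?D (Suc k) * ?J ^\<^sub>m Suc k * ?J"
      using mat_commute_pow[OF J J refl, of "Suc k"] by (simp add: assoc_mult_mat[OF D J Jk] assoc_mult_mat[OF D Jk J] del: pow_mat.simps(2))
    also have "?D k * ?J ^\<^sub>m Suc k = ?D k * ?J ^\<^sub>m k * ?J"
      by (simp add: assoc_mult_mat[OF D Jk J])
    finally show "?J * (?D (Suc k) * ?J ^\<^sub>m Suc k)
        = ?D (Suc k) * ?J ^\<^sub>m Suc k * ?J + ?D k * ?J ^\<^sub>m k * ?J" .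
  qed (rule mult_carrier_mat[OF D Jk])
qed

lemma unip_commute_index_eq_0:
  fixes M :: "'a :: ring_1 mat"
  assumes M: "M \<in> carrier_mat n n" "t > 0" "M * unip n t = unip n t * M"
    and "i < n" "a * t \<le> i" "j < a * t" 
  shows "M $$ (i, j) = 0"
  using assms(4-)
proof (induction a arbitrary: i j)
  case 0
  then show ?case by simp
next
  case (Suc a)
  define i' where "i' = i - t"
  have i: "i = i' + t" "a * t \<le> i'" "i' < n" "j < n"
    using Suc.prems by (auto simp: i'_def)
  have eq: "(if t \<le> j then M $$ (i', j - t) else 0) = (if i' + t < n then M $$ (i' + t, j) else 0)"
    using M(3) i unfolding unip_commute_iff[OF M(1,2)] by blast
  show ?case
  proof (cases "t \<le> j")
    case True
    then have "M $$ (i', j - t) = 0"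
      using Suc.prems i by (intro Suc.IH) auto
    then show ?thesis
      using eq True i Suc.prems by auto
  next
    case False
    then show ?thesis
      using eq i Suc.prems by auto
  qed
qed

text \<open>
  Writing \<open>l = c + d\<close> with \<open>q\<close> dividing \<open>c\<close> and \<open>0 < d < q\<close>, the entries \<open>\<psi> k $$ (c + k, c)\<close> all equal
  \<open>\<psi> 0 $$ (c, c) = 1\<close>, until the next one would lie in row \<open>l\<close>, outside the matrix.
\<close>

lemma dvd_if_rel_projective_jordan_block:
  assumes "prime p" and "CHAR('a :: comm_ring_1) = p"
    and "rel_projective (p ^ e) (jordan_block l (1 :: 'a))"
  shows "p ^ e dvd l"
proof (rule ccontr)
  let ?q = "p ^ e" and ?J = "jordan_block l (1 :: 'a)"
  assume ndvd: "\<not> ?q dvd l"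
  have q0: "?q > 0"
    using assms(1) by (simp add: prime_gt_0_nat)
  define c where "c = l div ?q * ?q"
  define d where "d = l mod ?q"
  have "l = c + d"
    unfolding c_def d_def by (rule div_mult_mod_eq[symmetric])
  moreover have "d > 0" "d < ?q"
    using ndvd q0 by (simp_all add: d_def mod_greater_zero_iff_not_dvd)
  ultimately have l: "l = c + d" "d > 0" "d < ?q" .
  obtain \<psi> :: "nat \<Rightarrow> 'a mat" where \<psi>: "\<psi> 0 = 1\<^sub>m l"
    and carr: "\<And>k. k < ?q \<Longrightarrow> \<psi> k \<in> carrier_mat l l"
    and comm: "\<And>k. k < ?q \<Longrightarrow> \<psi> k * unip l ?q = unip l ?q * \<psi> k"
    and step: "\<And>k. Suc k < ?q \<Longrightarrow> unip l 1 * \<psi> (Suc k) = \<psi> (Suc k) * unip l 1 + \<psi> k * unip l 1"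
    using assms(3) unfolding rel_projective_def jordan_block_1_pow_eq_unip[OF assms(1,2)]
    unfolding jordan_block_1_eq_unip carrier_matD[OF unip_carrier] by blast
  have col0: "(if 1 \<le> c then \<psi> k $$ (i, c - 1) else 0) = 0" if "k < ?q" "i < l" "c \<le> i" for k i
  proof (cases "c = 0")
    case False
    then show ?thesis
      using unip_commute_index_eq_0[OF carr[OF that(1)] q0 comm[OF that(1)] that(2), of "l div ?q" "c - 1"]
        that unfolding c_def[symmetric] by simp
  qed simp
  have step': "(if Suc i < l then \<psi> (Suc k) $$ (Suc i, c) else 0) = \<psi> k $$ (i, c)"
    if "Suc k < ?q" "i < l" "c \<le> i" for k i
  proof -
    have c: "c < l" and k: "k < ?q"
      using l that by auto
    note C = carr[OF that(1)] carr[OF k]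
    then have C': "\<psi> (Suc k) * unip l 1 \<in> carrier_mat l l" "\<psi> k * unip l 1 \<in> carrier_mat l l"
      by (auto intro: mult_carrier_mat)
    have "(unip l 1 * \<psi> (Suc k)) $$ (i, c) = (\<psi> (Suc k) * unip l 1) $$ (i, c) + (\<psi> k * unip l 1) $$ (i, c)"
      unfolding step[OF that(1)] using C' that(2) c by (intro index_add_mat) auto
    moreover have "(\<psi> (Suc k) * unip l 1) $$ (i, c) = \<psi> (Suc k) $$ (i, c)"
      using mult_unip_index[OF C(1) that(2) c, of 1] col0[OF that] by simp
    moreover have "(\<psi> k * unip l 1) $$ (i, c) = \<psi> k $$ (i, c)"
      using mult_unip_index[OF C(2) that(2) c, of 1] col0[OF k that(2,3)] by simp
    ultimately show ?thesis
      using unip_mult_index[OF C(1) that(2) c, of 1] by simp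
  qed
  have one: "\<psi> k $$ (c + k, c) = 1" if "k < d" for k
    using that
  proof (induction k)
    case 0
    then show ?case
      using l \<psi> by simp
  next
    case (Suc k)
    then show ?case
      using step'[of k "c + k"] l by simp
  qed
  show False
    using step'[of "d - 1" "l - 1"] one[of "d - 1"] l by simp
qed

subsection \<open>Passing to Jordan blocks\<close>

definition upper_left :: "nat \<Rightarrow> 'a mat \<Rightarrow> 'a mat" where
  "upper_left n M = mat n n (\<lambda>(i, j). M $$ (i, j))"

definition lower_right :: "nat \<Rightarrow> nat \<Rightarrow> 'a mat \<Rightarrow> 'a mat" where
  "lower_right n m M = mat m m (\<lambda>(i, j). M $$ (n + i, n + j))"

lemma upper_left_carrier [simp]: "upper_left n M \<in> carrier_mat n n"
  and lower_right_carrier [simp]: "lower_right n m M \<in> carrier_mat m m"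
  by (simp_all add: upper_left_def lower_right_def)

lemma upper_left_four_block:
  "A \<in> carrier_mat n n \<Longrightarrow> D \<in> carrier_mat m m \<Longrightarrow> upper_left n (four_block_mat A B C D) = A"
  by (rule eq_matI) (auto simp: upper_left_def)

lemma lower_right_four_block:
  "A \<in> carrier_mat n n \<Longrightarrow> D \<in> carrier_mat m m \<Longrightarrow> lower_right n m (four_block_mat A B C D) = D"
  by (rule eq_matI) (auto simp: lower_right_def)

lemma four_block_corners:
  assumes "M \<in> carrier_mat (n + m) (n + m)"
  obtains B C where "B \<in> carrier_mat n m" "C \<in> carrier_mat m n"
    "M = four_block_mat (upper_left n M) B C (lower_right n m M)"
proof
  show "M = four_block_mat (upper_left n M) (mat n m (\<lambda>(i, j). M $$ (i, n + j)))
      (mat m n (\<lambda>(i, j). M $$ (n + i, j))) (lower_right n m M)"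
    using assms by (intro eq_matI) (auto simp: upper_left_def lower_right_def)
qed auto

lemma corners_mult_block_diag:
  fixes X Y M :: "'a :: semiring_1 mat"
  assumes X: "X \<in> carrier_mat n n" and Y: "Y \<in> carrier_mat m m"
    and M: "M \<in> carrier_mat (n + m) (n + m)"
  defines "Z \<equiv> four_block_mat X (0\<^sub>m n m) (0\<^sub>m m n) Y"
  shows "upper_left n (M * Z ^\<^sub>m i) = upper_left n M * X ^\<^sub>m i"
    and "upper_left n (Z ^\<^sub>m i * M) = X ^\<^sub>m i * upper_left n M"
    and "lower_right n m (M * Z ^\<^sub>m i) = lower_right n m M * Y ^\<^sub>m i"
    and "lower_right n m (Z ^\<^sub>m i * M) = Y ^\<^sub>m i * lower_right n m M"
proof -
  let ?A = "upper_left n M" and ?D = "lower_right n m M"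
  have Xi: "X ^\<^sub>m i \<in> carrier_mat n n" and Yi: "Y ^\<^sub>m i \<in> carrier_mat m m"
    using X Y by simp_all
  have AX: "?A * X ^\<^sub>m i \<in> carrier_mat n n" "X ^\<^sub>m i * ?A \<in> carrier_mat n n"
    and DY: "?D * Y ^\<^sub>m i \<in> carrier_mat m m" "Y ^\<^sub>m i * ?D \<in> carrier_mat m m"
    using mult_carrier_mat[OF upper_left_carrier Xi] mult_carrier_mat[OF Xi upper_left_carrier]
      mult_carrier_mat[OF lower_right_carrier Yi] mult_carrier_mat[OF Yi lower_right_carrier] by simp_all
  obtain B C where BC: "B \<in> carrier_mat n m" "C \<in> carrier_mat m n"
    and M_eq: "M = four_block_mat ?A B C ?D"
    using M by (rule four_block_corners)
  have Z: "Z ^\<^sub>m i = four_block_mat (X ^\<^sub>m i) (0\<^sub>m n m) (0\<^sub>m m n) (Y ^\<^sub>m i)"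
    unfolding Z_def by (rule pow_four_block_mat[OF X Y])
  have "M * Z ^\<^sub>m i = four_block_mat ?A B C ?D * four_block_mat (X ^\<^sub>m i) (0\<^sub>m n m) (0\<^sub>m m n) (Y ^\<^sub>m i)"
    using M_eq Z by simp
  also have "\<dots> = four_block_mat (?A * X ^\<^sub>m i + B * 0\<^sub>m m n) (?A * 0\<^sub>m n m + B * Y ^\<^sub>m i)
      (C * X ^\<^sub>m i + ?D * 0\<^sub>m m n) (C * 0\<^sub>m n m + ?D * Y ^\<^sub>m i)"
    by (rule mult_four_block_mat) (use BC Xi Yi in auto)
  finally have R: "M * Z ^\<^sub>m i = \<dots>" .
  have "Z ^\<^sub>m i * M = four_block_mat (X ^\<^sub>m i) (0\<^sub>m n m) (0\<^sub>m m n) (Y ^\<^sub>m i) * four_block_mat ?A B C ?D"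
    using M_eq Z by simp
  also have "\<dots> = four_block_mat (X ^\<^sub>m i * ?A + 0\<^sub>m n m * C) (X ^\<^sub>m i * B + 0\<^sub>m n m * ?D)
      (0\<^sub>m m n * ?A + Y ^\<^sub>m i * C) (0\<^sub>m m n * B + Y ^\<^sub>m i * ?D)"
    by (rule mult_four_block_mat) (use BC Xi Yi in auto)
  finally have L: "Z ^\<^sub>m i * M = \<dots>" .
  show "upper_left n (M * Z ^\<^sub>m i) = ?A * X ^\<^sub>m i" "lower_right n m (M * Z ^\<^sub>m i) = ?D * Y ^\<^sub>m i"
    unfolding R using BC AX DY
    by (simp_all add: upper_left_four_block[of _ n _ m] lower_right_four_block[of _ n _ m])
  show "upper_left n (Z ^\<^sub>m i * M) = X ^\<^sub>m i * ?A" "lower_right n m (Z ^\<^sub>m i * M) = Y ^\<^sub>m i * ?D"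
    unfolding L using BC AX DY
    by (simp_all add: upper_left_four_block[of _ n _ m] lower_right_four_block[of _ n _ m])
qed

lemma rel_projective_block_diag:
  fixes X Y :: "'a :: semiring_1 mat"
  assumes X: "X \<in> carrier_mat n n" and Y: "Y \<in> carrier_mat m m"
    and Z: "rel_projective q (four_block_mat X (0\<^sub>m n m) (0\<^sub>m m n) Y)"
  shows "rel_projective q X" "rel_projective q Y"
proof -
  let ?Z = "four_block_mat X (0\<^sub>m n m) (0\<^sub>m m n) Y"
  have ZC: "?Z \<in> carrier_mat (n + m) (n + m)"
    using X Y by simp
  show "rel_projective q X"
    by (rule rel_projective_transfer[OF ZC X _ _ _ _ _ Z, where f = "upper_left n"])
      (auto simp: corners_mult_block_diag[OF X Y], auto simp: upper_left_def)
  show "rel_projective q Y"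
    by (rule rel_projective_transfer[OF ZC Y _ _ _ _ _ Z, where f = "lower_right n m"])
      (auto simp: corners_mult_block_diag[OF X Y], auto simp: lower_right_def)
qed

lemma rel_projective_jordan_matrix:
  fixes ls :: "nat list"
  assumes "rel_projective q (jordan_matrix (map (\<lambda>l. (l, 1 :: 'a :: semiring_1)) ls))" "l \<in> set ls"
  shows "rel_projective q (jordan_block l (1 :: 'a))"
  using assms
proof (induction ls)
  case (Cons k ls)
  let ?J = "jordan_matrix (map (\<lambda>l. (l, 1 :: 'a)) ls)"
  let ?n = "sum_list (map fst (map (\<lambda>l. (l, 1 :: 'a)) ls))"
  have "rel_projective q (four_block_mat (jordan_block k 1) (0\<^sub>m k ?n) (0\<^sub>m ?n k) ?J)"
    using Cons.prems(1) by (simp add: jordan_matrix_Cons)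
  note rel_projective_block_diag[OF jordan_block_carrier jordan_matrix_carrier this]
  with Cons show ?case
    by auto
qed simp

lemma similar_mat_conj:
  assumes "similar_mat A B" "A \<in> carrier_mat n n"
  obtains P Q where "P \<in> carrier_mat n n" "Q \<in> carrier_mat n n" "B \<in> carrier_mat n n"
    "P * Q = 1\<^sub>m n" "Q * P = 1\<^sub>m n" "\<And>i. A ^\<^sub>m i = P * B ^\<^sub>m i * Q"
proof -
  from assms(1) obtain P Q where wit: "similar_mat_wit A B P Q"
    unfolding similar_mat_def by blast
  from similar_mat_witD2[OF assms(2) wit] similar_mat_wit_pow_id[OF wit] that
  show thesis by blast
qed

lemma conj_mult_pow:
  fixes B P Q M :: "'a :: semiring_1 mat"
  assumes P: "P \<in> carrier_mat n n" and Q: "Q \<in> carrier_mat n n" and B: "B \<in> carrier_mat n n"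
    and QP: "Q * P = 1\<^sub>m n" and M: "M \<in> carrier_mat n n"
  shows "Q * (M * (P * B ^\<^sub>m i * Q)) * P = Q * M * P * B ^\<^sub>m i"
    and "Q * ((P * B ^\<^sub>m i * Q) * M) * P = B ^\<^sub>m i * (Q * M * P)"
proof -
  have Bi: "B ^\<^sub>m i \<in> carrier_mat n n"
    using B by simp
  note C = P Q Bi M
  note [simp] = mult_carrier_mat[of _ n n _ n] assoc_mult_mat[of _ n n _ n _ n]
  have Q_P: "Q * (P * N) = N" if "N \<in> carrier_mat n n" for N
    using assoc_mult_mat[OF Q P that] QP that by simp
  show "Q * (M * (P * B ^\<^sub>m i * Q)) * P = Q * M * P * B ^\<^sub>m i"
    using C QP right_mult_one_mat[OF Bi] by simp
  show "Q * ((P * B ^\<^sub>m i * Q) * M) * P = B ^\<^sub>m i * (Q * M * P)"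
    using C by (simp add: Q_P)
qed

lemma rel_projective_similar:
  fixes A B :: "'a :: comm_ring_1 mat"
  assumes "similar_mat A B" and A: "A \<in> carrier_mat n n" and "rel_projective q A"
  shows "rel_projective q B"
proof -
  obtain P Q where P: "P \<in> carrier_mat n n" and Q: "Q \<in> carrier_mat n n" and B: "B \<in> carrier_mat n n"
    and PQ: "P * Q = 1\<^sub>m n" "Q * P = 1\<^sub>m n" and pow: "\<And>i. A ^\<^sub>m i = P * B ^\<^sub>m i * Q"
    using similar_mat_conj[OF assms(1) A] by metis
  show ?thesis
  proof (rule rel_projective_transfer[OF A B _ _ _ _ _ assms(3), where f = "\<lambda>M. Q * M * P"])
    fix M N :: "'a mat" assume MN: "M \<in> carrier_mat n n" "N \<in> carrier_mat n n"
    show "Q * (M + N) * P = Q * M * P + Q * N * P"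
      using P Q MN by (simp add: mult_add_distrib_mat[of _ n n _ n] add_mult_distrib_mat[of _ n n _ _ n])
  qed (use P Q PQ in \<open>auto simp: pow conj_mult_pow[OF P Q B PQ(2)] intro!: mult_carrier_mat\<close>)
qed

subsection \<open>Commutants without trace\<close>

definition traceless_commutant :: "'a :: semiring_1 mat \<Rightarrow> bool" where
  "traceless_commutant X \<longleftrightarrow>
     (\<forall>M \<in> carrier_mat (dim_row X) (dim_row X). M * X = X * M \<longrightarrow> trace M = 0)"

lemma sum_periodic:
  fixes f :: "nat \<Rightarrow> 'a :: semiring_1"
  shows "(\<Sum>i<k * q. f (i mod q)) = of_nat k * (\<Sum>i<q. f i)"
proof -
  have "(\<Sum>i<k * q. f (i mod q)) = (\<Sum>a<k. \<Sum>b<q. f b)"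
    by (rule sum_div_mod[where f = "\<lambda>_. f"])
  then show ?thesis
    by simp
qed

lemma sum_lessThan_add:
  fixes f :: "nat \<Rightarrow> 'a :: comm_monoid_add"
  shows "(\<Sum>i<m + n. f i) = (\<Sum>i<m. f i) + (\<Sum>i<n. f (m + i))"
  by (induction n) (simp_all add: add.assoc)

lemma traceless_commutant_unip:
  assumes "q > 0" "CHAR('a :: comm_ring_1) * q dvd n"
  shows "traceless_commutant (unip n q :: 'a mat)"
  unfolding traceless_commutant_def
proof (intro ballI impI)
  fix M :: "'a mat"
  assume "M \<in> carrier_mat (dim_row (unip n q :: 'a mat)) (dim_row (unip n q :: 'a mat))"
    and comm: "M * unip n q = unip n q * M"
  then have M: "M \<in> carrier_mat n n"
    by (simp add: unip_def)
  have shift: "M $$ (i + q, i + q) = M $$ (i, i)" if "i + q < n" for i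
  proof -
    have "(if q \<le> i + q then M $$ (i, i + q - q) else 0) = (if i + q < n then M $$ (i + q, i + q) else 0)"
      using comm that add_lessD1[OF that] unfolding unip_commute_iff[OF M assms(1)] by blast
    then show ?thesis
      using that by simp
  qed
  have periodic: "M $$ (b + a * q, b + a * q) = M $$ (b, b)" if "b + a * q < n" for a b
    using that
  proof (induction a)
    case (Suc a)
    then show ?case
      using shift[of "b + a * q"] by (simp add: add_ac)
  qed simp
  have per: "M $$ (i, i) = M $$ (i mod q, i mod q)" if "i < n" for i
    using periodic[of "i mod q" "i div q"] that by (simp add: mod_div_mult_eq)
  obtain k where "n = CHAR('a) * q * k"
    using assms(2) by (rule dvdE)
  then have k: "n = (CHAR('a) * k) * q"
    by (simp only: mult_ac)
  have "trace M = (\<Sum>i<n. M $$ (i mod q, i mod q))"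
    using M by (auto simp: trace_def per intro!: sum.cong)
  also have "\<dots> = of_nat (CHAR('a) * k) * (\<Sum>i<q. M $$ (i, i))"
    unfolding k by (rule sum_periodic[of "\<lambda>i. M $$ (i, i)"])
  also have "\<dots> = 0"
    by simp
  finally show "trace M = 0" .
qed

lemma trace_eq_corners:
  assumes "M \<in> carrier_mat (n + m) (n + m)"
  shows "trace M = trace (upper_left n M) + trace (lower_right n m M)"
  using assms by (simp add: trace_def upper_left_def lower_right_def sum_lessThan_add)

lemma traceless_commutant_jordan_matrix:
  fixes ls :: "nat list"
  assumes "prime p" and "CHAR('a :: comm_ring_1) = p" and "\<And>l. l \<in> set ls \<Longrightarrow> p * p ^ e dvd l"
  shows "traceless_commutant (jordan_matrix (map (\<lambda>l. (l, 1 :: 'a)) ls) ^\<^sub>m (p ^ e))"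
  using assms(3)
proof (induction ls)
  case Nil
  then show ?case
    by (simp add: traceless_commutant_def trace_def)
next
  case (Cons k ls)
  let ?q = "p ^ e"
  let ?J = "jordan_matrix (map (\<lambda>l. (l, 1 :: 'a)) ls)"
  let ?n = "sum_list (map fst (map (\<lambda>l. (l, 1 :: 'a)) ls))"
  have J: "?J \<in> carrier_mat ?n ?n"
    by (rule jordan_matrix_carrier)
  let ?B = "jordan_block k (1 :: 'a)"
  let ?Z = "four_block_mat ?B (0\<^sub>m k ?n) (0\<^sub>m ?n k) ?J"
  have ZC: "?Z \<in> carrier_mat (k + ?n) (k + ?n)"
    using J by simp
  have "traceless_commutant (unip k ?q :: 'a mat)"
    using assms(1,2) Cons.prems[of k] by (intro traceless_commutant_unip) (auto simp: prime_gt_0_nat)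
  then have B: "trace M = 0" if "M \<in> carrier_mat k k" "M * ?B ^\<^sub>m ?q = ?B ^\<^sub>m ?q * M" for M
    using that unfolding traceless_commutant_def jordan_block_1_pow_eq_unip[OF assms(1,2)]
    by (simp add: carrier_matD[OF unip_carrier])
  have IH: "trace M = 0" if "M \<in> carrier_mat ?n ?n" "M * ?J ^\<^sub>m ?q = ?J ^\<^sub>m ?q * M" for M
    using that Cons unfolding traceless_commutant_def by simp
  have "trace M = 0" if M: "M \<in> carrier_mat (k + ?n) (k + ?n)" and comm: "M * ?Z ^\<^sub>m ?q = ?Z ^\<^sub>m ?q * M" for M
  proof -
    note corners = corners_mult_block_diag[OF jordan_block_carrier J M, of 1 ?q]
    have "trace (upper_left k M) = 0"
      by (rule B) (use corners(1,2) comm in auto)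
    moreover have "trace (lower_right k ?n M) = 0"
      by (rule IH) (use corners(3,4) comm in auto)
    ultimately show ?thesis
      by (simp add: trace_eq_corners[OF M])
  qed
  moreover have "jordan_matrix (map (\<lambda>l. (l, 1 :: 'a)) (k # ls)) = ?Z"
    by (simp add: jordan_matrix_Cons)
  ultimately show ?case
    using ZC unfolding traceless_commutant_def by (simp only: pow_mat_dim carrier_matD) simp
qed

lemma traceless_commutant_similar:
  fixes A B :: "'a :: comm_ring_1 mat"
  assumes "similar_mat A B" and A: "A \<in> carrier_mat n n" and "traceless_commutant (B ^\<^sub>m i)"
  shows "traceless_commutant (A ^\<^sub>m i)"
  unfolding traceless_commutant_def
proof (intro ballI impI)
  fix M assume "M \<in> carrier_mat (dim_row (A ^\<^sub>m i)) (dim_row (A ^\<^sub>m i))" and comm: "M * A ^\<^sub>m i = A ^\<^sub>m i * M"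
  then have M: "M \<in> carrier_mat n n"
    using A by simp
  obtain P Q where P: "P \<in> carrier_mat n n" and Q: "Q \<in> carrier_mat n n" and B: "B \<in> carrier_mat n n"
    and PQ: "P * Q = 1\<^sub>m n" "Q * P = 1\<^sub>m n" and pow: "\<And>i. A ^\<^sub>m i = P * B ^\<^sub>m i * Q"
    using similar_mat_conj[OF assms(1) A] by metis
  have QM: "Q * M \<in> carrier_mat n n"
    using Q M by (rule mult_carrier_mat)
  have "Q * M * P * B ^\<^sub>m i = B ^\<^sub>m i * (Q * M * P)"
    using comm unfolding pow by (metis conj_mult_pow[OF P Q B PQ(2) M])
  moreover have "Q * M * P \<in> carrier_mat (dim_row (B ^\<^sub>m i)) (dim_row (B ^\<^sub>m i))"
    using QM P B by simp
  ultimately have "trace (Q * M * P) = 0"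
    using assms(3) unfolding traceless_commutant_def by blast
  also have "trace (Q * M * P) = trace (P * (Q * M))"
    using QM P by (rule trace_mult_commute)
  also have "P * (Q * M) = M"
    using assoc_mult_mat[OF P Q M] PQ M by simp
  finally show "trace M = 0" .
qed

definition class_projector :: "nat \<Rightarrow> nat \<Rightarrow> nat \<Rightarrow> 'a :: semiring_1 mat" where
  "class_projector q n c = mat n n (\<lambda>(i, j). if i = j \<and> i mod q = c then 1 else 0)"

lemma class_projector_carrier [simp]: "class_projector q n c \<in> carrier_mat n n"
  by (simp add: class_projector_def)

lemma class_projector_commute:
  "q > 0 \<Longrightarrow> class_projector q n c * unip n q = unip n q * (class_projector q n c :: 'a :: ring_1 mat)"
  by (subst unip_commute_iff) (auto simp: class_projector_def le_mod_geq)

lemma trace_class_projector: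
  "trace (class_projector q n c :: 'a :: semiring_1 mat) = of_nat (card {i. i < n \<and> i mod q = c})"
proof -
  have "trace (class_projector q n c :: 'a mat) = (\<Sum>i<n. if i mod q = c then 1 else 0)"
    by (simp add: trace_def class_projector_def)
  also have "\<dots> = of_nat (card ({..<n} \<inter> {i. i mod q = c}))"
    by (simp add: sum.If_cases)
  also have "{..<n} \<inter> {i. i mod q = c} = {i. i < n \<and> i mod q = c}"
    by auto
  finally show ?thesis .
qed

lemma card_residue_class:
  assumes "c < q"
  shows "card {i. i < k * q + d \<and> i mod q = c} = k + card {i. i < d \<and> i mod q = c}"
proof -
  have count: "card {i. i < n \<and> i mod q = c} = (\<Sum>i<n. if i mod q = c then 1 else 0)" for n
  proof -
    have "{i. i < n \<and> i mod q = c} = {..<n} \<inter> {i. i mod q = c}"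
      by auto
    then show ?thesis
      by (simp add: sum.If_cases)
  qed
  have "(\<Sum>i<k * q. if i mod q = c then 1 else 0) = k"
    using sum_periodic[of "\<lambda>i. if i = c then 1 else 0 :: nat" q k] assms by simp
  then show ?thesis
    unfolding count sum_lessThan_add by simp
qed

lemma ex_residue_class_not_dvd:
  fixes p q n :: nat
  assumes "q > 0" "\<not> p * q dvd n" "p \<noteq> 1"
  shows "\<exists>c. \<not> p dvd card {i. i < n \<and> i mod q = c}"
proof (rule ccontr)
  assume "\<not> ?thesis"
  then have dvd: "p dvd card {i. i < n \<and> i mod q = c}" for c
    by blast
  define k where "k = n div q"
  define d where "d = n mod q"
  have n: "n = k * q + d" and d: "d < q"
    using assms(1) by (simp_all add: d_def k_def)
  have card: "card {i. i < n \<and> i mod q = c} = k + card {i. i < d \<and> i mod q = c}" if "c < q" for c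
    unfolding n using that by (rule card_residue_class)
  have "{i. i < d \<and> i mod q = q - 1} = {}"
    using d by auto
  then have "p dvd k"
    using dvd[of "q - 1"] card[of "q - 1"] assms(1) by (simp only: card.empty) simp
  moreover have "d > 0"
    using assms(2) n \<open>p dvd k\<close> by (auto intro: Nat.gr0I simp: mult_dvd_mono)
  have "i mod q = i" if "i < d" for i
    using that d by simp
  with \<open>d > 0\<close> have "{i. i < d \<and> i mod q = 0} = {0}"
    by force
  then have "p dvd Suc k"
    using dvd[of 0] card[of 0] assms(1) by simp
  ultimately have "p dvd Suc k - k"
    by (rule dvd_diff_nat[rotated])
  then show False
    using assms(3) by simp
qed

theorem theorem2:
  fixes p r s :: nat and ls :: "nat list"
  assumes "prime p" and "CHAR('a :: field) = p"
    and "r \<ge> 1" and "s \<ge> 1"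
    and "jordan_partition TYPE('a) r s ls"
    and "length ls = min r s"
  shows "p_part p (lcm r s) = p_part p (Gcd (set ls))"
proof -
  let ?Jr = "jordan_block r (1 :: 'a)" and ?Js = "jordan_block s (1 :: 'a)"
  let ?G = "kronecker ?Jr ?Js"
  let ?J = "jordan_matrix (map (\<lambda>l. (l, 1 :: 'a)) ls)"
  have G: "?G \<in> carrier_mat (r * s) (r * s)"
    by simp
  have sim: "similar_mat ?G ?J"
    using assms(5) by (simp add: jordan_partition_def jordan_nf_def)
  define e where "e = multiplicity p (lcm r s)"
  let ?q = "p ^ e"
  have q0: "?q > 0"
    using assms(1) by (simp add: prime_gt_0_nat)
  have e: "e = max (multiplicity p r) (multiplicity p s)"
    unfolding e_def using assms(1,3,4) by (intro multiplicity_lcm) auto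
  have "?q dvd Gcd (set ls)"
  proof (rule Gcd_greatest)
    fix l assume l: "l \<in> set ls"
    have "?q dvd r \<or> ?q dvd s"
      unfolding e max_def by (auto simp: multiplicity_dvd)
    then have "rel_projective ?q ?G"
    proof
      assume "?q dvd r"
      then show ?thesis
        by (intro rel_projective_kronecker_left[of _ r _ s] rel_projective_jordan_block[OF assms(1,2)]) auto
    next
      assume "?q dvd s"
      then show ?thesis
        by (intro rel_projective_kronecker_right[of _ r _ s] rel_projective_jordan_block[OF assms(1,2)]) auto
    qed
    then have "rel_projective ?q ?J"
      by (rule rel_projective_similar[OF sim G])
    then show "?q dvd l"
      using l by (intro dvd_if_rel_projective_jordan_block[OF assms(1,2)] rel_projective_jordan_matrix)
  qed
  moreover have "\<not> p ^ Suc e dvd Gcd (set ls)"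
  proof
    assume dvd: "p ^ Suc e dvd Gcd (set ls)"
    have "p * ?q dvd l" if "l \<in> set ls" for l
      using dvd_trans[OF dvd Gcd_dvd[OF that]] by simp
    then have "traceless_commutant (?J ^\<^sub>m ?q)"
      by (rule traceless_commutant_jordan_matrix[OF assms(1,2)])
    then have "traceless_commutant (?G ^\<^sub>m ?q)"
      by (rule traceless_commutant_similar[OF sim G])
    moreover have "?G ^\<^sub>m ?q = kronecker (unip r ?q) (unip s ?q)"
      by (simp add: kronecker_pow[of _ r _ s] jordan_block_1_pow_eq_unip[OF assms(1,2)])
    ultimately have traceless: "trace M = 0" if "M \<in> carrier_mat (r * s) (r * s)"
      "M * kronecker (unip r ?q) (unip s ?q) = kronecker (unip r ?q) (unip s ?q) * M" for M :: "'a mat"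
      using that unfolding traceless_commutant_def
      by (simp add: carrier_matD[OF kronecker_carrier[OF unip_carrier unip_carrier]])
    have "\<not> p * ?q dvd n" if "multiplicity p n \<le> e" "n \<ge> 1" for n
    proof -
      have "p ^ Suc e dvd n \<longleftrightarrow> Suc e \<le> multiplicity p n"
        using that(2) assms(1) by (intro power_dvd_iff_le_multiplicity) auto
      with that(1) show ?thesis
        by simp
    qed
    then have "\<not> p * ?q dvd r" "\<not> p * ?q dvd s"
      using e assms(3,4) by auto
    then obtain a b where ab: "\<not> p dvd card {i. i < r \<and> i mod ?q = a}" "\<not> p dvd card {i. i < s \<and> i mod ?q = b}"
      using ex_residue_class_not_dvd[OF q0] assms(1) by (metis not_prime_1)
    let ?A = "class_projector ?q r a :: 'a mat" and ?B = "class_projector ?q s b :: 'a mat"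
    have "trace (kronecker ?A ?B) = 0"
      by (rule traceless)
        (simp_all add: kronecker_mult[of _ r _ _ s] class_projector_commute[OF q0])
    then have "of_nat (card {i. i < r \<and> i mod ?q = a}) * of_nat (card {i. i < s \<and> i mod ?q = b}) = (0 :: 'a)"
      by (simp add: trace_kronecker[of _ r _ s] trace_class_projector)
    with ab assms(2) show False
      by (simp add: of_nat_eq_0_iff_char_dvd)
  qed
  ultimately have "multiplicity p (Gcd (set ls)) = e"
    by (rule multiplicity_eqI)
  then show ?thesis
    by (simp add: p_part_def e_def)
qed

end
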